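(* Let $V$ be a countably generated self-dual Hilbert module over a unital $C^*$-algebra $A$. Then $V$ has the property (mBS1) if and only if it has the property (mBS2).
   Context: Hilbert modules are right Hilbert $C^*$-modules, with $A$-valued inner product $\langle\cdot,\cdot\rangle$ that is $A$-linear in the second variable. A Hilbert $A$-module $V$ is countably generated if there is a sequence in $V$ whose finite $A$-linear combinations are norm-dense in $V$. $V$ is self-dual if every bounded $A$-linear map $f:V\to A$ is of the form $f=\langle x,\cdot\rangle$ for some $x\in V$. The topology $\tau_{\widehat V}$ on $V$ is the locally convex topology generated by the seminorms $x\mapsto\|\langle z,x\rangle\|$, $z\in V$. A sequence $\{x_n\}$ in $V$ is called $\tau_{\widehat V}$-convergent if for every $z\in V$ the sequence $\{\langle z,x_n\rangle\}$ converges in norm in $A$ (so the limit may lie in the completion of $V$ with respect to $\tau_{\widehat V}$, not necessarily in $V$), and $\tau_{\widehat V}$-null if $\|\langle z,x_n\rangle\|\to0$ for every $z\in V$. (mBS1): every $\tau_{\widehat V}$-null sequence $\{x_n\}$ in $V$ admits a subsequence $\{x_{n(i)}\}$ with $\lim_{k\to\infty}\|\frac1k\sum_{i=1}^k x_{n(i)}\|=0$. (mBS2): every $\tau_{\widehat V}$-convergent sequence $\{x_n\}$ in $V$ admits a subsequence $\{x_{n(i)}\}$ such that the sequence $\frac1k\sum_{i=1}^k x_{n(i)}$, $k\in\mathbb N$, converges in norm (to an element of $V$). *)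

theory Defs
  imports "HOL-Analysis.Analysis"
begin

class complex_normed_vector = real_normed_vector +
  fixes scaleC :: "complex \<Rightarrow> 'a \<Rightarrow> 'a"  (infixr "*\<^sub>C" 75)
  assumes scaleC_add_right: "c *\<^sub>C (x + y) = c *\<^sub>C x + c *\<^sub>C y"
    and scaleC_add_left: "(c + d) *\<^sub>C x = c *\<^sub>C x + d *\<^sub>C x"
    and scaleC_scaleC: "c *\<^sub>C (d *\<^sub>C x) = (c * d) *\<^sub>C x"
    and scaleC_of_real: "complex_of_real r *\<^sub>C x = r *\<^sub>R x"
    and norm_scaleC: "norm (c *\<^sub>C x) = cmod c * norm x"

class cstar_algebra = complex_normed_vector + real_normed_algebra + complete_space +
  fixes adj :: "'a \<Rightarrow> 'a"
  assumes mult_scaleC_left: "(c *\<^sub>C x) * y = c *\<^sub>C (x * y)"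
    and mult_scaleC_right: "x * (c *\<^sub>C y) = c *\<^sub>C (x * y)"
    and adj_add: "adj (x + y) = adj x + adj y"
    and adj_scaleC: "adj (c *\<^sub>C x) = cnj c *\<^sub>C adj x"
    and adj_mult: "adj (x * y) = adj y * adj x"
    and adj_adj: "adj (adj x) = x"
    and norm_adj_mult: "norm (adj x * x) = (norm x)\<^sup>2"

text \<open>The unit comes from \<^class>\<open>monoid_mult\<close> rather than \<^class>\<open>ring_1\<close>, so the zero
  algebra is not excluded.\<close>

class unital_cstar_algebra = cstar_algebra + monoid_mult

definition cstar_spectrum :: "'a::unital_cstar_algebra \<Rightarrow> complex set" where
  "cstar_spectrum a = {c. \<not> (\<exists>b. (a - c *\<^sub>C 1) * b = 1 \<and> b * (a - c *\<^sub>C 1) = 1)}"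

definition cstar_positive :: "'a::unital_cstar_algebra \<Rightarrow> bool" where
  "cstar_positive a \<longleftrightarrow> adj a = a \<and> cstar_spectrum a \<subseteq> {complex_of_real r | r. 0 \<le> r}"

text \<open>Right Hilbert modules. The norm and the completeness of the module are those of its type,
  and \<open>norm_eq\<close> says that this norm is the one given by the inner product; \<open>norm_eq\<close> also
  yields definiteness, \<open>ip x x = 0 \<Longrightarrow> x = 0\<close>.\<close>

locale hilbert_module =
  fixes act :: "'v::{complex_normed_vector, complete_space} \<Rightarrow> 'a::unital_cstar_algebra \<Rightarrow> 'v"
      (infixl "\<cdot>" 76)
    and ip :: "'v \<Rightarrow> 'v \<Rightarrow> 'a"
  assumes act_add_left: "(x + y) \<cdot> a = x \<cdot> a + y \<cdot> a"
    and act_add_right: "x \<cdot> (a + b) = x \<cdot> a + x \<cdot> b"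
    and act_mult: "x \<cdot> (a * b) = (x \<cdot> a) \<cdot> b"
    and act_one: "x \<cdot> 1 = x"
    and act_scaleC_left: "(c *\<^sub>C x) \<cdot> a = c *\<^sub>C (x \<cdot> a)"
    and act_scaleC_right: "x \<cdot> (c *\<^sub>C a) = c *\<^sub>C (x \<cdot> a)"
    and ip_add_right: "ip x (y + z) = ip x y + ip x z"
    and ip_scaleC_right: "ip x (c *\<^sub>C y) = c *\<^sub>C ip x y"
    and ip_act_right: "ip x (y \<cdot> a) = ip x y * a"
    and ip_adj: "adj (ip x y) = ip y x"
    and ip_positive: "cstar_positive (ip x x)"
    and norm_eq: "norm x = sqrt (norm (ip x x))"

definition countably_generated ::
  "('v::real_normed_vector \<Rightarrow> 'a \<Rightarrow> 'v) \<Rightarrow> bool" where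
  "countably_generated act \<longleftrightarrow>
     (\<exists>g :: nat \<Rightarrow> 'v. closure {\<Sum>i\<in>F. act (g i) (a i) | F a. finite F} = UNIV)"

text \<open>Complex linearity of \<open>f\<close> is not listed separately in the following definition: since the
  algebra is unital, it is the case \<open>a = c *\<^sub>C 1\<close> of the last condition.\<close>

definition bounded_A_linear ::
  "('v::complex_normed_vector \<Rightarrow> 'a::unital_cstar_algebra \<Rightarrow> 'v) \<Rightarrow> ('v \<Rightarrow> 'a) \<Rightarrow> bool" where
  "bounded_A_linear act f \<longleftrightarrow> bounded_linear f \<and> (\<forall>x a. f (act x a) = f x * a)"

definition self_dual ::
  "('v::complex_normed_vector \<Rightarrow> 'a::unital_cstar_algebra \<Rightarrow> 'v) \<Rightarrow> ('v \<Rightarrow> 'v \<Rightarrow> 'a) \<Rightarrow> bool" where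
  "self_dual act ip \<longleftrightarrow> (\<forall>f. bounded_A_linear act f \<longrightarrow> (\<exists>x. f = ip x))"

definition tau_convergent ::
  "('v \<Rightarrow> 'v \<Rightarrow> 'a::real_normed_vector) \<Rightarrow> (nat \<Rightarrow> 'v) \<Rightarrow> bool" where
  "tau_convergent ip x \<longleftrightarrow> (\<forall>z. convergent (\<lambda>n. ip z (x n)))"

definition tau_null ::
  "('v \<Rightarrow> 'v \<Rightarrow> 'a::real_normed_vector) \<Rightarrow> (nat \<Rightarrow> 'v) \<Rightarrow> bool" where
  "tau_null ip x \<longleftrightarrow> (\<forall>z. (\<lambda>n. norm (ip z (x n))) \<longlonglongrightarrow> 0)"

definition cesaro_mean :: "(nat \<Rightarrow> 'v::real_vector) \<Rightarrow> nat \<Rightarrow> 'v" where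
  "cesaro_mean y k = (1 / real k) *\<^sub>R (\<Sum>i<k. y i)"

definition mBS1 ::
  "('v::real_normed_vector \<Rightarrow> 'v \<Rightarrow> 'a::real_normed_vector) \<Rightarrow> bool" where
  "mBS1 ip \<longleftrightarrow> (\<forall>x. tau_null ip x \<longrightarrow>
     (\<exists>r. strict_mono r \<and> (\<lambda>k. norm (cesaro_mean (x \<circ> r) k)) \<longlonglongrightarrow> 0))"

definition mBS2 ::
  "('v::real_normed_vector \<Rightarrow> 'v \<Rightarrow> 'a::real_normed_vector) \<Rightarrow> bool" where
  "mBS2 ip \<longleftrightarrow> (\<forall>x. tau_convergent ip x \<longrightarrow>
     (\<exists>r. strict_mono r \<and> convergent (cesaro_mean (x \<circ> r))))"

end

theory Submission
  imports Defs
begin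

text \<open>The limit functional \<open>z \<mapsto> lim \<langle>x\<^sub>n, z\<rangle>\<close> of a \<open>\<tau>\<close>-convergent sequence is bounded by the uniform
  boundedness principle, so self-duality makes it \<open>\<langle>x, \<cdot>\<rangle>\<close> for some \<open>x\<close>, and (mBS1) applies to
  \<open>x\<^sub>n - x\<close>. Conversely, a norm limit of Cesaro means of a \<open>\<tau>\<close>-null sequence is orthogonal to
  everything, hence zero.\<close>

section \<open>Uniform boundedness of sequences of operators\<close>

text \<open>By pointwise boundedness the closed sets \<open>S k\<close> cover the complete domain,
  so by Baire one of them contains a closed ball; linearity carries the bound on that ball to the
  whole space.\<close>

theorem uniform_boundedness_sequence:
  fixes T :: "nat \<Rightarrow> 'a::{real_normed_vector, complete_space} \<Rightarrow> 'b::real_normed_vector"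
  assumes lin: "\<And>n. bounded_linear (T n)"
    and bdd: "\<And>x. Bseq (\<lambda>n. T n x)"
  shows "\<exists>K. \<forall>n x. norm (T n x) \<le> K * norm x"
proof -
  define S where "S k = {x. \<forall>n. norm (T n x) \<le> real k}" for k :: nat
  have clo: "closed (S k)" for k
    unfolding S_def
    by (intro closed_Collect_all closed_Collect_le continuous_on_norm continuous_on_const
        linear_continuous_on lin)
  have cover: "\<Union>(range S) = UNIV"
  proof -
    have "\<exists>k. x \<in> S k" for x
    proof -
      obtain K where "\<And>n. norm (T n x) \<le> K"
        using bdd[of x] unfolding Bseq_def by blast
      then show ?thesis
        unfolding S_def using real_arch_simple[of K] order_trans by blast
    qed
    then show ?thesis by auto
  qed
  have "\<exists>k. interior (S k) \<noteq> {}"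
  proof (rule ccontr)
    assume "\<not> ?thesis"
    then have "euclidean interior_of \<Union>(range S) = {}"
      by (intro Baire_category_alt)
        (auto simp: completely_metrizable_space_euclidean clo)
    with cover show False by simp
  qed
  then obtain k a r where "r > 0" and ball: "cball a r \<subseteq> S k"
    unfolding ex_in_conv[symmetric] mem_interior_cball by blast
  have "norm (T n x) \<le> (2 * real k / r) * norm x" for n x
  proof (cases "x = 0")
    case True
    then show ?thesis by (simp add: linear_simps[OF lin])
  next
    case False
    \<comment> \<open>Rescaled to length \<open>r\<close>, so that \<open>a + y\<close> stays in the
      ball. Writing \<open>y\<close> as the difference of \<open>a + y\<close> and \<open>a\<close>
      costs the factor 2 in the bound.\<close>
    define y where "y = (r / norm x) *\<^sub>R x"
    have "a + y \<in> cball a r" "a \<in> cball a r"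
      using \<open>r > 0\<close> False by (auto simp: y_def dist_norm)
    then have "norm (T n (a + y)) \<le> k" "norm (T n a) \<le> k"
      using ball unfolding S_def by blast+
    moreover have "T n y = T n (a + y) - T n a"
      by (simp add: linear_simps[OF lin])
    ultimately have "norm (T n y) \<le> 2 * real k"
      using norm_triangle_ineq4[of "T n (a + y)" "T n a"] by simp
    moreover have "norm (T n y) = r / norm x * norm (T n x)"
      using \<open>r > 0\<close> by (simp add: y_def linear_simps[OF lin])
    ultimately show ?thesis
      using \<open>r > 0\<close> False by (simp add: field_simps)
  qed
  then show ?thesis by blast
qed

section \<open>Cesaro means\<close>

lemma cesaro_mean_null:
  fixes b :: "nat \<Rightarrow> 'a::real_normed_vector"
  assumes "b \<longlonglongrightarrow> 0"
  shows "cesaro_mean b \<longlonglongrightarrow> 0"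
proof (rule LIMSEQ_I)
  fix e :: real
  assume "e > 0"
  then obtain N where N: "\<And>n. n \<ge> N \<Longrightarrow> norm (b n) < e / 2"
    using LIMSEQ_D[OF assms, of "e / 2"] by auto
  \<comment> \<open>\<open>C\<close> bounds the head of the sum for every \<open>k\<close>, and past
    \<open>M\<close> it is less than \<open>k * (e / 2)\<close>; the tail terms, each below
    \<open>e / 2\<close>, supply the other half.\<close>
  define C where "C = (\<Sum>i<N. norm (b i))"
  obtain M :: nat where M: "2 * C / e < real M"
    using reals_Archimedean2 by blast
  show "\<exists>n0. \<forall>n\<ge>n0. norm (cesaro_mean b n - 0) < e"
  proof (intro exI allI impI)
    fix k
    assume k: "k \<ge> Suc (max M N)"
    then have "2 * C / e < real k" using M by linarith
    then have C: "C < real k * (e / 2)" using \<open>e > 0\<close> by (simp add: field_simps)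
    have "norm (\<Sum>i<k. b i) \<le> (\<Sum>i<k. norm (b i))" by (rule norm_sum)
    also have "\<dots> = C + (\<Sum>i=N..<k. norm (b i))"
      unfolding C_def lessThan_atLeast0 using k by (subst sum.atLeastLessThan_concat) auto
    also have "(\<Sum>i=N..<k. norm (b i)) \<le> of_nat (card {N..<k}) * (e / 2)"
      using N by (intro sum_bounded_above) (auto intro: less_imp_le)
    also have "\<dots> \<le> real k * (e / 2)"
      using \<open>e > 0\<close> by (intro mult_right_mono) auto
    finally have "norm (\<Sum>i<k. b i) < real k * e" using C by simp
    then show "norm (cesaro_mean b k - 0) < e"
      using k by (simp add: cesaro_mean_def field_simps)
  qed
qed

text \<open>At \<open>k = 0\<close> both means are 0, the sums being empty, so the identity would
  force \<open>c = 0\<close>.\<close>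

lemma cesaro_mean_diff_const:
  assumes "k > 0"
  shows "cesaro_mean (\<lambda>i. y i - c) k = cesaro_mean y k - c"
  using assms by (simp add: cesaro_mean_def sum_subtractf scaleR_diff_right sum_constant_scaleR)

lemma bounded_linear_cesaro_mean:
  assumes "bounded_linear f"
  shows "f (cesaro_mean y k) = cesaro_mean (\<lambda>i. f (y i)) k"
  using assms by (simp add: cesaro_mean_def linear_simps bounded_linear.linear linear_sum)

section \<open>The involution\<close>

lemma norm_adj: "norm (adj x) = norm x" for x :: "'a::cstar_algebra"
proof -
  have le: "norm y \<le> norm (adj y)" for y :: 'a
  proof (cases "y = 0")
    case False
    \<comment> \<open>The C*-identity followed by submultiplicativity; cancelling
      \<open>norm y\<close> leaves one inequality, and \<open>adj_adj\<close> gives the reverse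
      one.\<close>
    have "norm y * norm y \<le> norm (adj y) * norm y"
      using norm_mult_ineq[of "adj y" y] by (simp add: norm_adj_mult power2_eq_square)
    with False show ?thesis by simp
  qed simp
  show ?thesis using le[of x] le[of "adj x"] by (simp add: adj_adj)
qed

lemma adj_scaleR: "adj (r *\<^sub>R x) = r *\<^sub>R adj x" for x :: "'a::cstar_algebra"
  by (metis adj_scaleC complex_cnj_complex_of_real scaleC_of_real)

lemma bounded_linear_adj: "bounded_linear (adj :: 'a::cstar_algebra \<Rightarrow> 'a)"
  by (rule bounded_linear_intro[where K = 1]) (simp_all add: adj_add adj_scaleR norm_adj)

section \<open>Boundedness of the inner product\<close>

context hilbert_module
begin

lemma ip_add_left: "ip (x + y) z = ip x z + ip y z"
  by (metis adj_add ip_add_right ip_adj)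

lemma ip_scaleC_left: "ip (c *\<^sub>C x) y = cnj c *\<^sub>C ip x y"
  by (metis adj_scaleC ip_scaleC_right ip_adj)

lemma ip_scaleR_right: "ip x (r *\<^sub>R y) = r *\<^sub>R ip x y"
  by (metis ip_scaleC_right scaleC_of_real)

lemma ip_scaleR_left: "ip (r *\<^sub>R x) y = r *\<^sub>R ip x y"
  by (metis adj_scaleR ip_scaleR_right ip_adj)

lemma norm_ip_self: "norm (ip x x) = (norm x)\<^sup>2"
  by (simp add: norm_eq)

text \<open>Expanding \<open>ip (x + y) (x + y)\<close> leaves only diagonal values, whose norms are
  squares of vector norms; 6 is \<open>2\<^sup>2 + 1 + 1\<close>.\<close>

lemma norm_ip_symmetrized_le:
  assumes "norm x \<le> 1" "norm y \<le> 1"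
  shows "norm (ip x y + ip y x) \<le> 6"
proof -
  have eq: "ip x y + ip y x = ip (x + y) (x + y) - (ip x x + ip y y)"
    by (simp add: ip_add_left ip_add_right)
  have "norm (x + y) \<le> 2"
    using norm_triangle_ineq[of x y] assms by linarith
  then have "(norm (x + y))\<^sup>2 \<le> 2\<^sup>2" "(norm x)\<^sup>2 \<le> 1\<^sup>2" "(norm y)\<^sup>2 \<le> 1\<^sup>2"
    using assms by (intro power_mono; simp)+
  then show ?thesis
    unfolding eq
    using norm_triangle_ineq4[of "ip (x + y) (x + y)" "ip x x + ip y y"]
      norm_triangle_ineq[of "ip x x" "ip y y"]
    by (simp add: norm_ip_self)
qed

text \<open>By polarization; this avoids the Cauchy-Schwarz inequality, whose proof needs positivity in
  the algebra.\<close>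

lemma norm_ip_le_unit:
  assumes "norm x \<le> 1" "norm y \<le> 1"
  shows "norm (ip x y) \<le> 6"
proof -
  \<comment> \<open>Since \<open>ip\<close> is conjugate-linear on the left, replacing
    \<open>y\<close> by \<open>\<i> *\<^sub>C y\<close> and multiplying by \<open>-\<i>\<close>
    turns the symmetrized sum into \<open>ip x y - ip y x\<close>. Adding the original sum isolates
    \<open>2 *\<^sub>R ip x y\<close>.\<close>
  have "norm (\<i> *\<^sub>C y) \<le> 1" using assms by (simp add: norm_scaleC)
  then have 2: "norm (ip x (\<i> *\<^sub>C y) + ip (\<i> *\<^sub>C y) x) \<le> 6"
    using assms norm_ip_symmetrized_le by blast
  have "(-\<i>) *\<^sub>C (ip x (\<i> *\<^sub>C y) + ip (\<i> *\<^sub>C y) x) = ip x y + (-1) *\<^sub>C ip y x"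
    using scaleC_of_real[of 1 "ip x y"]
    by (simp add: ip_scaleC_right ip_scaleC_left scaleC_add_right scaleC_scaleC)
  also have "(-1) *\<^sub>C ip y x = - ip y x"
    using scaleC_of_real[of "-1" "ip y x"] by simp
  finally have "2 *\<^sub>R ip x y
      = (ip x y + ip y x) + (-\<i>) *\<^sub>C (ip x (\<i> *\<^sub>C y) + ip (\<i> *\<^sub>C y) x)"
    by (simp add: scaleR_2)
  then have "2 * norm (ip x y)
      = norm ((ip x y + ip y x) + (-\<i>) *\<^sub>C (ip x (\<i> *\<^sub>C y) + ip (\<i> *\<^sub>C y) x))"
    by (metis norm_scaleR abs_numeral)
  also have "\<dots> \<le> norm (ip x y + ip y x)
      + norm ((-\<i>) *\<^sub>C (ip x (\<i> *\<^sub>C y) + ip (\<i> *\<^sub>C y) x))"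
    by (rule norm_triangle_ineq)
  also have "\<dots> \<le> 6 + 6"
    using norm_ip_symmetrized_le[OF assms] 2 by (simp add: norm_scaleC)
  finally show ?thesis by simp
qed

text \<open>Homogeneity reduces nonzero vectors to unit vectors. The constant 6 is not sharp, but
  any constant makes \<open>ip x\<close> a bounded operator.\<close>

lemma norm_ip_le: "norm (ip x y) \<le> 6 * norm x * norm y"
proof (cases "x = 0 \<or> y = 0")
  case True
  then show ?thesis
    using ip_scaleR_left[of 0 x y] ip_scaleR_right[of x 0 y] by auto
next
  case False
  have "norm (ip ((1 / norm x) *\<^sub>R x) ((1 / norm y) *\<^sub>R y)) \<le> 6"
    by (rule norm_ip_le_unit) (use False in auto)
  then show ?thesis
    using False by (simp add: ip_scaleR_left ip_scaleR_right field_simps)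
qed

lemma bounded_linear_ip: "bounded_linear (ip x)"
  by (rule bounded_linear_intro[where K = "6 * norm x"])
    (auto simp: ip_add_right ip_scaleR_right intro: order_trans[OF norm_ip_le])

section \<open>Limits of \<tau>-convergent sequences\<close>

lemma tau_convergent_imp_shifted_tau_null:
  assumes "self_dual (\<cdot>) ip" "tau_convergent ip x"
  shows "\<exists>x0. tau_null ip (\<lambda>n. x n - x0)"
proof -
  \<comment> \<open>Convergence is given with \<open>x n\<close> in the second slot, but the limit
    functional is A-linear only with its argument there; the continuous involution swaps the
    slots.\<close>
  have conv: "convergent (\<lambda>n. ip (x n) z)" for z
  proof -
    obtain l where "(\<lambda>n. ip z (x n)) \<longlonglongrightarrow> l"
      using assms(2) unfolding tau_convergent_def convergent_def by blast
    then have "(\<lambda>n. adj (ip z (x n))) \<longlonglongrightarrow> adj l"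
      by (rule bounded_linear.tendsto[OF bounded_linear_adj])
    then show ?thesis by (auto simp: ip_adj convergent_def)
  qed
  define f where "f z = lim (\<lambda>n. ip (x n) z)" for z
  have f: "(\<lambda>n. ip (x n) z) \<longlonglongrightarrow> f z" for z
    using conv[of z] by (simp add: f_def convergent_LIMSEQ_iff)
  \<comment> \<open>A bound uniform in \<open>n\<close> survives the limit and so bounds
    \<open>f\<close>.\<close>
  obtain K where K: "\<And>n z. norm (ip (x n) z) \<le> K * norm z"
    using uniform_boundedness_sequence[of "\<lambda>n. ip (x n)"] bounded_linear_ip
      convergent_imp_Bseq[OF conv] by blast
  have "bounded_linear f"
  proof (rule bounded_linear_intro[where K = K])
    fix y z :: 'v and r :: real
    show "f (y + z) = f y + f z"
      using f[of "y + z"] tendsto_add[OF f f, of y z]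
      by (simp add: ip_add_right LIMSEQ_unique)
    show "f (r *\<^sub>R z) = r *\<^sub>R f z"
      using f[of "r *\<^sub>R z"] tendsto_scaleR[OF tendsto_const f, of r z]
      by (simp add: ip_scaleR_right LIMSEQ_unique)
    show "norm (f z) \<le> norm z * K"
      using Lim_bounded[OF tendsto_norm[OF f]] K by (simp add: mult.commute)
  qed
  moreover have "f (z \<cdot> a) = f z * a" for z a
    using f[of "z \<cdot> a"] tendsto_mult[OF f tendsto_const, of z a]
    by (simp add: ip_act_right LIMSEQ_unique)
  \<comment> \<open>Self-duality places the limit, a priori only in the \<tau>-completion, in the
    module itself.\<close>
  ultimately obtain x0 where x0: "f = ip x0"
    using assms(1) unfolding self_dual_def bounded_A_linear_def by blast
  have "(\<lambda>n. norm (ip z (x n - x0))) \<longlonglongrightarrow> 0" for z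
  proof -
    \<comment> \<open>The involution is isometric, so the slots can be swapped back without changing
      norms.\<close>
    have "norm (ip z (x n - x0)) = norm (ip (x n) z - f z)" for n
    proof -
      have "adj (ip z (x n - x0)) = ip (x n) z - f z"
        by (simp add: linear_simps[OF bounded_linear_ip] linear_simps[OF bounded_linear_adj]
            ip_adj x0)
      then show ?thesis by (metis norm_adj)
    qed
    then show ?thesis
      using f[of z] by (simp add: LIM_zero tendsto_norm_zero)
  qed
  then show ?thesis unfolding tau_null_def by blast
qed

section \<open>The two implications\<close>

lemma mBS1_imp_mBS2:
  assumes "self_dual (\<cdot>) ip" "mBS1 ip"
  shows "mBS2 ip"
  unfolding mBS2_def
proof (intro allI impI)
  fix x
  assume "tau_convergent ip x"
  then obtain x0 where "tau_null ip (\<lambda>n. x n - x0)"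
    using tau_convergent_imp_shifted_tau_null assms(1) by blast
  then obtain r where r: "strict_mono r"
    and "(\<lambda>k. norm (cesaro_mean ((\<lambda>n. x n - x0) \<circ> r) k)) \<longlonglongrightarrow> 0"
    using assms(2) unfolding mBS1_def by blast
  then have "(\<lambda>k. cesaro_mean (\<lambda>i. (x \<circ> r) i - x0) k) \<longlonglongrightarrow> 0"
    by (simp add: tendsto_norm_zero_iff comp_def)
  moreover have "eventually (\<lambda>k. cesaro_mean (\<lambda>i. (x \<circ> r) i - x0) k
      = cesaro_mean (x \<circ> r) k - x0) sequentially"
    using eventually_gt_at_top[of 0] by eventually_elim (rule cesaro_mean_diff_const)
  ultimately have "(\<lambda>k. cesaro_mean (x \<circ> r) k - x0) \<longlonglongrightarrow> 0"
    by (rule Lim_transform_eventually)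
  then have "cesaro_mean (x \<circ> r) \<longlonglongrightarrow> x0" by (rule LIM_zero_cancel)
  with r show "\<exists>r. strict_mono r \<and> convergent (cesaro_mean (x \<circ> r))"
    unfolding convergent_def by blast
qed

lemma mBS2_imp_mBS1:
  assumes "mBS2 ip"
  shows "mBS1 ip"
  unfolding mBS1_def
proof (intro allI impI)
  fix x
  assume "tau_null ip x"
  then have null: "(\<lambda>n. ip z (x n)) \<longlonglongrightarrow> 0" for z
    unfolding tau_null_def tendsto_norm_zero_iff by blast
  then have "tau_convergent ip x"
    unfolding tau_convergent_def convergent_def by blast
  then obtain r y where r: "strict_mono r" and y: "cesaro_mean (x \<circ> r) \<longlonglongrightarrow> y"
    using assms unfolding mBS2_def convergent_def by blast
  \<comment> \<open>Testing against the limit \<open>y\<close> itself suffices: the same scalar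
    means tend to \<open>ip y y\<close> by continuity and to 0 as Cesaro means of a null
    sequence.\<close>
  have "(\<lambda>k. ip y (cesaro_mean (x \<circ> r) k)) \<longlonglongrightarrow> ip y y"
    by (rule bounded_linear.tendsto[OF bounded_linear_ip y])
  moreover have "cesaro_mean (\<lambda>i. ip y ((x \<circ> r) i)) \<longlonglongrightarrow> 0"
    using LIMSEQ_subseq_LIMSEQ[OF null r] by (intro cesaro_mean_null) (simp add: comp_def)
  ultimately have "ip y y = 0"
    by (simp add: bounded_linear_cesaro_mean[OF bounded_linear_ip] LIMSEQ_unique)
  then have "y = 0" using norm_eq[of y] by simp
  with y have "(\<lambda>k. norm (cesaro_mean (x \<circ> r) k)) \<longlonglongrightarrow> 0"
    by (simp add: tendsto_norm_zero)
  with r show "\<exists>r. strict_mono r \<and> (\<lambda>k. norm (cesaro_mean (x \<circ> r) k)) \<longlonglongrightarrow> 0"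
    by blast
qed

end

theorem corollary6p6:
  fixes act :: "'v::{complex_normed_vector, complete_space} \<Rightarrow> 'a::unital_cstar_algebra \<Rightarrow> 'v"
    and ip :: "'v \<Rightarrow> 'v \<Rightarrow> 'a"
  assumes "hilbert_module act ip"
    and "countably_generated act"
    and "self_dual act ip"
  shows "mBS1 ip \<longleftrightarrow> mBS2 ip"
  using hilbert_module.mBS1_imp_mBS2[OF assms(1,3)] hilbert_module.mBS2_imp_mBS1[OF assms(1)]
  by blast

end
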